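(* Let $P$ be a poset on a nonempty finite set $K$ with $|K|=k$, let $d'(P)=\max\{d(P|_A)\mid A\subsetneq K\}$ and $\varepsilon(P)=d'(P)/d(P)$. Then $d'(P)\le 2^{k-1}$, $\varepsilon(P)<1$, and for every positive integer $m$ $$0\le r(m,P):=d(P)^m-e(m,P)\le 2^{m(P)-1}d'(P)^m\le 2^{(k-1)(m+1)},$$ so that $e(m,P)=d(P)^m\bigl(1-O(\varepsilon(P)^m)\bigr)$ as $m\to\infty$; in particular $e(m,P)$ is asymptotically equal to $d(P)^m$.
   Context: $d(\cdot)$ is the number of downsets of a finite poset, $P|_A$ the induced subposet on $A$, $m(P)$ the number of minimal elements of $P$. For a finite poset $P$ on $K$ and a finite set $M$ disjoint from $K$ with $|M|=m$, $e(m,P)$ is the number of partial orders on $M\cup K$ inducing $P$ on $K$ whose set of minimal elements is exactly $M$. *)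

theory Defs
  imports "HOL-Library.Landau_Symbols"
begin

text \<open>
  A poset on a carrier \<open>K\<close> is given by its reflexive order relation \<open>P\<close>, where \<open>(x, y) \<in> P\<close>
  means \<open>x \<le> y\<close> and \<open>partial_order_on K P\<close> holds (which includes \<open>P \<subseteq> K \<times> K\<close>).
  The induced subposet on \<open>A\<close> is \<open>Restr P A\<close>.
\<close>

definition downsets :: "'a set \<Rightarrow> 'a rel \<Rightarrow> 'a set set" where
  "downsets K P = {D. D \<subseteq> K \<and> (\<forall>y\<in>D. \<forall>x\<in>K. (x, y) \<in> P \<longrightarrow> x \<in> D)}"

definition num_downsets :: "'a set \<Rightarrow> 'a rel \<Rightarrow> nat" where
  "num_downsets K P = card (downsets K P)"

definition minimal_elements :: "'a set \<Rightarrow> 'a rel \<Rightarrow> 'a set" where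
  "minimal_elements K P = {x \<in> K. \<forall>y\<in>K. (y, x) \<in> P \<longrightarrow> y = x}"

definition num_minimal :: "'a set \<Rightarrow> 'a rel \<Rightarrow> nat" where
  "num_minimal K P = card (minimal_elements K P)"

definition max_proper_downsets :: "'a set \<Rightarrow> 'a rel \<Rightarrow> nat" where
  "max_proper_downsets K P = Max {num_downsets A (Restr P A) | A. A \<subset> K}"

definition downset_ratio :: "'a set \<Rightarrow> 'a rel \<Rightarrow> real" where
  "downset_ratio K P = real (max_proper_downsets K P) / real (num_downsets K P)"

definition extensions :: "'a set \<Rightarrow> 'a set \<Rightarrow> 'a rel \<Rightarrow> 'a rel set" where
  "extensions M K P =
     {R. partial_order_on (M \<union> K) R \<and> Restr R K = P \<and> minimal_elements (M \<union> K) R = M}"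

text \<open>
  The number \<open>e(m, P)\<close>. Since the type \<open>'a\<close> need not contain \<open>m\<close> elements outside \<open>K\<close>, the
  disjoint sets \<open>M\<close> and \<open>K\<close> are realised in the sum type \<open>'a + nat\<close>; by
  \<open>num_extensions_eq\<close> below, any other \<open>m\<close>-element set \<open>M\<close> disjoint from \<open>K\<close> gives the
  same number.
\<close>

definition num_extensions :: "nat \<Rightarrow> 'a set \<Rightarrow> 'a rel \<Rightarrow> nat" where
  "num_extensions m K P =
     card (extensions (Inr ` {..<m} :: ('a + nat) set) (Inl ` K) (map_prod Inl Inl ` P))"

definition extension_deficit :: "nat \<Rightarrow> 'a set \<Rightarrow> 'a rel \<Rightarrow> int" where
  "extension_deficit m K P = int (num_downsets K P) ^ m - int (num_extensions m K P)"

lemma extensions_subset: "R \<in> extensions M K P \<Longrightarrow> R \<subseteq> (M \<union> K) \<times> (M \<union> K)"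
  by (simp add: extensions_def partial_order_onD(4))

lemma extensions_image:
  assumes inj: "inj_on f (M \<union> K)" and P: "P \<subseteq> K \<times> K" and R: "R \<in> extensions M K P"
  shows "map_prod f f ` R \<in> extensions (f ` M) (f ` K) (map_prod f f ` P)"
proof -
  let ?S = "map_prod f f ` R"
  have po: "partial_order_on (M \<union> K) R" and rs: "Restr R K = P"
    and mn: "minimal_elements (M \<union> K) R = M"
    using R by (auto simp: extensions_def)
  have sub: "R \<subseteq> (M \<union> K) \<times> (M \<union> K)" and rf: "refl_on (M \<union> K) R"
    and tr: "trans R" and an: "antisym R"
    using partial_order_onD[OF po] by auto
  have iff: "(f x, f y) \<in> ?S \<longleftrightarrow> (x, y) \<in> R" if "x \<in> M \<union> K" "y \<in> M \<union> K" for x y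
  proof
    assume "(f x, f y) \<in> ?S"
    then obtain a b where ab: "(a, b) \<in> R" "f x = f a" "f y = f b" by auto
    with sub have "a \<in> M \<union> K" "b \<in> M \<union> K" by blast+
    with ab that inj have "x = a" "y = b" by (meson inj_onD)+
    with ab show "(x, y) \<in> R" by simp
  qed (auto intro: rev_image_eqI)
  have ex: "\<exists>x y. x \<in> M \<union> K \<and> y \<in> M \<union> K \<and> u = f x \<and> v = f y \<and> (x, y) \<in> R"
    if uv: "(u, v) \<in> ?S" for u v
  proof -
    obtain x y where "(x, y) \<in> R" "u = f x" "v = f y" using uv by auto
    with sub show ?thesis by blast
  qed
  have S_sub: "?S \<subseteq> (f ` M \<union> f ` K) \<times> (f ` M \<union> f ` K)"
    using ex by blast
  have S_refl: "refl_on (f ` M \<union> f ` K) ?S"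
    using rf iff unfolding refl_on_def by blast
  have S_trans: "trans ?S"
  proof (rule transI)
    fix u v w assume "(u, v) \<in> ?S" "(v, w) \<in> ?S"
    then obtain x y y' z where h: "x \<in> M \<union> K" "y \<in> M \<union> K" "u = f x" "v = f y" "(x, y) \<in> R"
      "y' \<in> M \<union> K" "z \<in> M \<union> K" "v = f y'" "w = f z" "(y', z) \<in> R"
      using ex by metis
    then have "y = y'" using inj by (metis inj_onD)
    then have "(x, z) \<in> R" using h tr by (meson transD)
    then show "(u, w) \<in> ?S" using h iff by simp
  qed
  have S_antisym: "antisym ?S"
  proof (rule antisymI)
    fix u v assume a: "(u, v) \<in> ?S" "(v, u) \<in> ?S"
    then obtain x y where h: "x \<in> M \<union> K" "y \<in> M \<union> K" "u = f x" "v = f y" "(x, y) \<in> R"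
      using ex by metis
    then have "(y, x) \<in> R" using a iff by simp
    then show "u = v" using h an by (metis antisymD)
  qed
  have "partial_order_on (f ` M \<union> f ` K) ?S"
    using S_sub S_refl S_trans S_antisym by (simp add: partial_order_on_def preorder_on_def)
  moreover have "Restr ?S (f ` K) = map_prod f f ` P"
  proof (intro subset_antisym subrelI)
    fix u v assume "(u, v) \<in> Restr ?S (f ` K)"
    then have "u \<in> f ` K" "v \<in> f ` K" and uv: "(u, v) \<in> ?S" by blast+
    from this(1,2) obtain x y where xy: "x \<in> K" "y \<in> K" "u = f x" "v = f y"
      by (elim imageE)
    with uv iff have "(x, y) \<in> R" by simp
    with xy rs have "(x, y) \<in> P" by blast
    then have "map_prod f f (x, y) \<in> map_prod f f ` P" by (rule imageI)
    with xy show "(u, v) \<in> map_prod f f ` P" by simp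
  next
    fix u v assume "(u, v) \<in> map_prod f f ` P"
    then obtain x y where "(x, y) \<in> P" "u = f x" "v = f y" by auto
    moreover from this P rs have "x \<in> K" "y \<in> K" "(x, y) \<in> R" by blast+
    ultimately show "(u, v) \<in> Restr ?S (f ` K)" using iff by simp
  qed
  moreover have "minimal_elements (f ` M \<union> f ` K) ?S = f ` M"
  proof -
    have feq: "f x = f y \<longleftrightarrow> x = y" if "x \<in> M \<union> K" "y \<in> M \<union> K" for x y
      using inj that by (meson inj_onD)
    have mem: "f x \<in> minimal_elements (f ` (M \<union> K)) ?S \<longleftrightarrow> x \<in> minimal_elements (M \<union> K) R"
      if "x \<in> M \<union> K" for x
      using that by (simp add: minimal_elements_def iff feq del: Un_iff)
    have "minimal_elements (f ` (M \<union> K)) ?S = f ` minimal_elements (M \<union> K) R"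
    proof (intro subset_antisym subsetI)
      fix u assume u: "u \<in> minimal_elements (f ` (M \<union> K)) ?S"
      then have "u \<in> f ` (M \<union> K)" by (simp add: minimal_elements_def)
      then obtain x where "x \<in> M \<union> K" "u = f x" by (elim imageE)
      with u mem show "u \<in> f ` minimal_elements (M \<union> K) R" by simp
    next
      fix u assume "u \<in> f ` minimal_elements (M \<union> K) R"
      then obtain x where x: "x \<in> minimal_elements (M \<union> K) R" "u = f x" by (elim imageE)
      then have "x \<in> M \<union> K" by (simp add: minimal_elements_def)
      with x mem show "u \<in> minimal_elements (f ` (M \<union> K)) ?S" by simp
    qed
    then show ?thesis by (simp add: mn image_Un)
  qed
  ultimately show ?thesis by (simp add: extensions_def)
qed

lemma card_extensions_image:
  assumes inj: "inj_on f (M \<union> K)" and P: "P \<subseteq> K \<times> K"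
  shows "card (extensions (f ` M) (f ` K) (map_prod f f ` P)) = card (extensions M K P)"
proof -
  define g where "g = inv_into (M \<union> K) f"
  have gf: "g (f x) = x" if "x \<in> M \<union> K" for x
    using inj that by (simp add: g_def)
  have fg: "f (g y) = y" if "y \<in> f ` M \<union> f ` K" for y
    using that by (metis g_def f_inv_into_f image_Un)
  have gM: "g ` f ` M = M" and gK: "g ` f ` K = K"
    using gf by (simp_all add: image_image cong: image_cong)
  have gfR: "map_prod g g ` map_prod f f ` R = R" if "R \<subseteq> (M \<union> K) \<times> (M \<union> K)" for R
  proof -
    have "(map_prod g g \<circ> map_prod f f) ` R = id ` R"
      using that gf by (intro image_cong) auto
    then show ?thesis by (simp add: image_comp)
  qed
  have fgS: "map_prod f f ` map_prod g g ` S = S"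
    if "S \<subseteq> (f ` M \<union> f ` K) \<times> (f ` M \<union> f ` K)" for S
  proof -
    have "(map_prod f f \<circ> map_prod g g) ` S = id ` S"
      using that fg by (intro image_cong) auto
    then show ?thesis by (simp add: image_comp)
  qed
  have g_inj: "inj_on g (f ` M \<union> f ` K)"
    by (metis fg inj_onI)
  have fP: "map_prod f f ` P \<subseteq> f ` K \<times> f ` K" using P by auto
  have gP: "map_prod g g ` map_prod f f ` P = P" by (rule gfR) (use P in blast)
  have "bij_betw ((`) (map_prod f f)) (extensions M K P)
      (extensions (f ` M) (f ` K) (map_prod f f ` P))"
  proof (rule bij_betw_byWitness[where f' = "(`) (map_prod g g)"])
    show "\<forall>R\<in>extensions M K P. map_prod g g ` map_prod f f ` R = R"
      by (intro ballI gfR extensions_subset)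
    show "\<forall>S\<in>extensions (f ` M) (f ` K) (map_prod f f ` P). map_prod f f ` map_prod g g ` S = S"
      by (intro ballI fgS extensions_subset)
    show "(`) (map_prod f f) ` extensions M K P \<subseteq> extensions (f ` M) (f ` K) (map_prod f f ` P)"
      using extensions_image[OF inj P] by (intro image_subsetI)
    show "(`) (map_prod g g) ` extensions (f ` M) (f ` K) (map_prod f f ` P) \<subseteq> extensions M K P"
      using extensions_image[OF g_inj fP] unfolding gM gK gP by (intro image_subsetI)
  qed
  then show ?thesis by (metis bij_betw_same_card)
qed

lemma num_extensions_eq:
  assumes "partial_order_on K P" and "finite M" and "M \<inter> K = {}" and "card M = m"
  shows "card (extensions M K P) = num_extensions m K P"
proof -
  obtain h where h: "bij_betw h M {..<m}"
    using assms(2,4) by (metis ex_bij_betw_finite_nat atLeast0LessThan)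
  define f :: "'a \<Rightarrow> 'a + nat" where "f = (\<lambda>x. if x \<in> K then Inl x else Inr (h x))"
  have P: "P \<subseteq> K \<times> K" using assms(1) by (rule partial_order_onD)
  have "inj_on f (M \<union> K)"
    using h by (auto simp: inj_on_def f_def bij_betw_def)
  moreover have "f ` K = Inl ` K" by (auto simp: f_def)
  moreover have "f ` M = Inr ` {..<m}"
  proof -
    have "f ` M = Inr ` h ` M"
      unfolding image_image using assms(3) by (intro image_cong) (auto simp: f_def)
    then show ?thesis using h by (simp add: bij_betw_def)
  qed
  moreover have "map_prod f f ` P = map_prod Inl Inl ` P"
    using P by (intro image_cong) (auto simp: f_def)
  ultimately show ?thesis
    using card_extensions_image[of f M K P] P by (simp add: num_extensions_def)
qed

end

theory Submission
  imports Defs "HOL-Library.FuncSet"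
begin

text \<open>
  Write \<open>d = d(P)\<close> and \<open>d' = d'(P)\<close>. An order on \<open>M \<union> K\<close> that induces \<open>P\<close> on \<open>K\<close> and in which all
  points of \<open>M\<close> are minimal is determined by the downsets \<open>f i = {y \<in> K. \<not> i \<le> y}\<close>, \<open>i \<in> M\<close>, of \<open>K\<close>,
  and every family of downsets arises in this way. A point of \<open>K\<close> is minimal in this order iff it is
  minimal in \<open>P\<close> and lies in all \<open>f i\<close>. Hence \<open>d ^ m - e(m, P)\<close> counts the families of downsets with a
  common minimal element \<open>p\<close> of \<open>P\<close>. Deleting \<open>p\<close> embeds the downsets containing \<open>p\<close> into the downsets
  of \<open>K - {p}\<close>, so at most \<open>d' ^ m\<close> families share a given \<open>p\<close>.

  For a proper subset \<open>A\<close> of \<open>K\<close>, intersecting with \<open>A\<close> maps the downsets of \<open>K\<close> onto those of \<open>A\<close>, but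
  identifies the principal downset of any \<open>p \<in> K - A\<close> with the same set without \<open>p\<close>. Hence \<open>d' < d\<close>.
\<close>

section \<open>Numbers of downsets\<close>

lemma downsets_subset_Pow: "downsets K P \<subseteq> Pow K"
  by (auto simp: downsets_def)

lemma finite_downsets: "finite K \<Longrightarrow> finite (downsets K P)"
  by (rule finite_subset[OF downsets_subset_Pow]) simp

lemma num_downsets_le_power: "finite K \<Longrightarrow> num_downsets K P \<le> 2 ^ card K"
  unfolding num_downsets_def card_Pow[symmetric]
  by (intro card_mono downsets_subset_Pow) simp

lemma num_downsets_pos: "finite K \<Longrightarrow> 0 < num_downsets K P"
  unfolding num_downsets_def using finite_downsets[of K P]
  by (auto simp: card_gt_0_iff downsets_def)

lemma converse_Image_in_downsets:
  assumes "trans P" and "P \<subseteq> K \<times> K"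
  shows "P\<inverse> `` D \<in> downsets K P"
  using assms by (auto simp: downsets_def dest: transD)

lemma downsets_Restr:
  assumes "preorder_on K P" and "A \<subseteq> K"
  shows "downsets A (Restr P A) = (\<lambda>D. D \<inter> A) ` downsets K P"
proof (intro subset_antisym subsetI)
  have refl: "refl_on K P" and trans: "trans P" and sub: "P \<subseteq> K \<times> K"
    using assms(1) by (auto simp: preorder_on_def)
  fix D assume D: "D \<in> downsets A (Restr P A)"
  then have "D = P\<inverse> `` D \<inter> A"
    using refl assms(2) by (auto simp: downsets_def refl_on_def)
  then show "D \<in> (\<lambda>D. D \<inter> A) ` downsets K P"
    using converse_Image_in_downsets[OF trans sub] by blast
next
  fix D assume "D \<in> (\<lambda>D. D \<inter> A) ` downsets K P"
  then show "D \<in> downsets A (Restr P A)"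
    using assms(2) by (auto simp: downsets_def)
qed

lemma num_downsets_Restr_less:
  assumes "finite K" and po: "partial_order_on K P" and A: "A \<subset> K"
  shows "num_downsets A (Restr P A) < num_downsets K P"
proof -
  have refl: "refl_on K P" and trans: "trans P" and antisym: "antisym P" and sub: "P \<subseteq> K \<times> K"
    using partial_order_onD[OF po] by auto
  obtain p where p: "p \<in> K" "p \<notin> A" using A by blast
  let ?D = "P\<inverse> `` {p}"
  have D: "?D \<in> downsets K P"
    using trans sub by (rule converse_Image_in_downsets)
  then have D_minus: "?D - {p} \<in> downsets K P"
    using antisym by (auto simp: downsets_def dest: antisymD)
  have "p \<in> ?D" using refl p(1) by (auto simp: refl_on_def)
  then have "?D \<noteq> ?D - {p}" by blast
  moreover have "?D \<inter> A = (?D - {p}) \<inter> A" using p(2) by blast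
  ultimately have "\<not> inj_on (\<lambda>D. D \<inter> A) (downsets K P)"
    using D D_minus by (meson inj_onD)
  then have "card ((\<lambda>D. D \<inter> A) ` downsets K P) < card (downsets K P)"
    using finite_downsets[OF assms(1)] by (metis card_image_le inj_on_iff_eq_card nat_less_le)
  then show ?thesis
    using downsets_Restr[of K P A] po A
    by (simp add: num_downsets_def partial_order_on_def psubset_imp_subset)
qed

lemma finite_num_downsets_proper:
  "finite K \<Longrightarrow> finite {num_downsets A (Restr P A) | A. A \<subset> K}"
  by (rule finite_subset[of _ "(\<lambda>A. num_downsets A (Restr P A)) ` Pow K"]) auto

lemma num_downsets_Restr_le_max:
  "finite K \<Longrightarrow> A \<subset> K \<Longrightarrow> num_downsets A (Restr P A) \<le> max_proper_downsets K P"
  unfolding max_proper_downsets_def by (rule Max_ge[OF finite_num_downsets_proper]) auto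

lemma max_proper_downsets_attained:
  assumes "finite K" and "K \<noteq> {}"
  obtains A where "A \<subset> K" and "max_proper_downsets K P = num_downsets A (Restr P A)"
proof -
  have "max_proper_downsets K P \<in> {num_downsets A (Restr P A) | A. A \<subset> K}"
    unfolding max_proper_downsets_def
    using assms by (intro Max_in finite_num_downsets_proper) auto
  then show ?thesis using that by blast
qed

lemma max_proper_downsets_le_power:
  assumes "finite K" and "K \<noteq> {}"
  shows "max_proper_downsets K P \<le> 2 ^ (card K - 1)"
proof -
  obtain A where A: "A \<subset> K" "max_proper_downsets K P = num_downsets A (Restr P A)"
    using max_proper_downsets_attained[OF assms] .
  then have "max_proper_downsets K P \<le> 2 ^ card A"
    using assms(1) by (metis finite_subset num_downsets_le_power psubset_imp_subset)
  also have "(2::nat) ^ card A \<le> 2 ^ (card K - 1)"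
    using psubset_card_mono[OF assms(1) A(1)] by (intro power_increasing) auto
  finally show ?thesis .
qed

lemma max_proper_downsets_less:
  "finite K \<Longrightarrow> K \<noteq> {} \<Longrightarrow> partial_order_on K P \<Longrightarrow> max_proper_downsets K P < num_downsets K P"
  by (metis max_proper_downsets_attained num_downsets_Restr_less)

lemma downset_ratio_less_1:
  "finite K \<Longrightarrow> K \<noteq> {} \<Longrightarrow> partial_order_on K P \<Longrightarrow> downset_ratio K P < 1"
  using max_proper_downsets_less[of K P] by (simp add: downset_ratio_def)

lemma card_downsets_containing_le:
  assumes "finite K" and "p \<in> K"
  shows "card {D \<in> downsets K P. p \<in> D} \<le> max_proper_downsets K P"
proof -
  let ?A = "K - {p}"
  have "inj_on (\<lambda>D. D - {p}) {D \<in> downsets K P. p \<in> D}"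
    by (rule inj_onI) blast
  moreover have "(\<lambda>D. D - {p}) ` {D \<in> downsets K P. p \<in> D} \<subseteq> downsets ?A (Restr P ?A)"
    by (auto simp: downsets_def)
  ultimately have "card {D \<in> downsets K P. p \<in> D} \<le> num_downsets ?A (Restr P ?A)"
    unfolding num_downsets_def using assms(1) by (intro card_inj_on_le finite_downsets) auto
  also have "\<dots> \<le> max_proper_downsets K P"
    using assms by (intro num_downsets_Restr_le_max) auto
  finally show ?thesis .
qed

lemma finite_minimal_elements: "finite K \<Longrightarrow> finite (minimal_elements K P)"
  by (simp add: minimal_elements_def)

lemma num_minimal_le_card: "finite K \<Longrightarrow> num_minimal K P \<le> card K"
  unfolding num_minimal_def by (rule card_mono) (auto simp: minimal_elements_def)

section \<open>Orders adding minimal elements, and families of downsets\<close>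

definition family_extension :: "'b set \<Rightarrow> 'a set \<Rightarrow> 'a rel \<Rightarrow> ('b \<Rightarrow> 'a set) \<Rightarrow> ('a + 'b) rel" where
  "family_extension M K P f =
     map_prod Inl Inl ` P \<union> Id_on (Inr ` M) \<union> {(Inr i, Inl y) | i y. i \<in> M \<and> y \<in> K - f i}"

lemma family_extension_iff [simp]:
  "(Inl x, Inl y) \<in> family_extension M K P f \<longleftrightarrow> (x, y) \<in> P"
  "(Inr i, Inl y) \<in> family_extension M K P f \<longleftrightarrow> i \<in> M \<and> y \<in> K - f i"
  "(Inr i, Inr j) \<in> family_extension M K P f \<longleftrightarrow> i \<in> M \<and> i = j"
  "(Inl x, Inr j) \<notin> family_extension M K P f"
  by (auto simp: family_extension_def)

lemma partial_order_on_family_extension: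
  assumes po: "partial_order_on K P" and f: "f \<in> M \<rightarrow> downsets K P"
  shows "partial_order_on (Inr ` M \<union> Inl ` K) (family_extension M K P f)"
proof -
  let ?R = "family_extension M K P f" and ?N = "Inr ` M \<union> Inl ` K"
  have refl: "refl_on K P" and trans: "trans P" and antisym: "antisym P" and sub: "P \<subseteq> K \<times> K"
    using partial_order_onD[OF po] by auto
  have up: "y \<in> K" "y \<notin> f i" if "i \<in> M" "x \<in> K" "x \<notin> f i" "(x, y) \<in> P" for i x y
    using that f sub by (auto simp: downsets_def Pi_iff)
  have "refl_on ?N ?R"
    using refl by (auto simp: refl_on_def)
  moreover have "trans ?R"
  proof (rule transI)
    fix u v w assume "(u, v) \<in> ?R" "(v, w) \<in> ?R"
    then show "(u, w) \<in> ?R"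
      by (cases u; cases v; cases w) (auto intro: transD[OF trans] dest: up)
  qed
  moreover have "antisym ?R"
  proof (rule antisymI)
    fix u v assume "(u, v) \<in> ?R" "(v, u) \<in> ?R"
    then show "u = v" using antisym by (cases u; cases v) (auto dest: antisymD)
  qed
  moreover have "?R \<subseteq> ?N \<times> ?N"
    using sub by (auto simp: family_extension_def)
  ultimately show ?thesis
    by (simp add: partial_order_on_def preorder_on_def)
qed

lemma Restr_family_extension:
  "P \<subseteq> K \<times> K \<Longrightarrow> Restr (family_extension M K P f) (Inl ` K) = map_prod Inl Inl ` P"
  by (auto simp: family_extension_def)

lemma minimal_elements_family_extension:
  "minimal_elements (Inr ` M \<union> Inl ` K) (family_extension M K P f)
     = Inr ` M \<union> Inl ` (minimal_elements K P \<inter> (\<Inter>i\<in>M. f i))"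
  (is "?L = ?R")
proof (rule set_eqI)
  show "u \<in> ?L \<longleftrightarrow> u \<in> ?R" for u
    by (cases u) (auto simp: minimal_elements_def ball_Un image_iff)
qed

lemma inj_on_family_extension: "inj_on (family_extension M K P) (M \<rightarrow>\<^sub>E Pow K)"
proof (rule inj_onI)
  fix f g assume f: "f \<in> M \<rightarrow>\<^sub>E Pow K" and g: "g \<in> M \<rightarrow>\<^sub>E Pow K"
    and eq: "family_extension M K P f = family_extension M K P g"
  show "f = g"
  proof (rule PiE_ext[OF f g])
    fix i assume i: "i \<in> M"
    have "y \<in> K - f i \<longleftrightarrow> y \<in> K - g i" for y
      using i eq family_extension_iff(2)[of i y M K P] by blast
    moreover have "f i \<subseteq> K" "g i \<subseteq> K" using f g i by auto
    ultimately show "f i = g i" by blast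
  qed
qed

definition extension_family :: "'b set \<Rightarrow> 'a set \<Rightarrow> ('a + 'b) rel \<Rightarrow> 'b \<Rightarrow> 'a set" where
  "extension_family M K R = (\<lambda>i\<in>M. {y \<in> K. (Inr i, Inl y) \<notin> R})"

lemma Restr_Inl_iff:
  assumes "Restr R (Inl ` K) = map_prod Inl Inl ` P" and "x \<in> K" and "y \<in> K"
  shows "(Inl x, Inl y) \<in> R \<longleftrightarrow> (x, y) \<in> P"
proof -
  have "(Inl x, Inl y) \<in> R \<longleftrightarrow> (Inl x, Inl y) \<in> Restr R (Inl ` K)"
    using assms(2,3) by simp
  also have "\<dots> \<longleftrightarrow> (x, y) \<in> P"
    unfolding assms(1) by auto
  finally show ?thesis .
qed

lemma extension_family_in_PiE:
  assumes trans: "trans R" and Restr: "Restr R (Inl ` K) = map_prod Inl Inl ` P"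
  shows "extension_family M K R \<in> M \<rightarrow>\<^sub>E downsets K P"
proof (rule PiE_I)
  fix i assume "i \<in> M"
  then show "extension_family M K R i \<in> downsets K P"
    using trans Restr_Inl_iff[OF Restr]
    by (auto simp: extension_family_def downsets_def dest: transD)
qed (simp add: extension_family_def)

lemma family_extension_extension_family:
  assumes po: "partial_order_on (Inr ` M \<union> Inl ` K) R"
    and P: "P \<subseteq> K \<times> K" and Restr: "Restr R (Inl ` K) = map_prod Inl Inl ` P"
    and minimal: "Inr ` M \<subseteq> minimal_elements (Inr ` M \<union> Inl ` K) R"
  shows "family_extension M K P (extension_family M K R) = R"
proof -
  have refl: "refl_on (Inr ` M \<union> Inl ` K) R"
    and sub: "R \<subseteq> (Inr ` M \<union> Inl ` K) \<times> (Inr ` M \<union> Inl ` K)"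
    using partial_order_onD[OF po] by auto
  have minimalD: "u = Inr i" if "(u, Inr i) \<in> R" for u i
  proof -
    have "u \<in> Inr ` M \<union> Inl ` K" "Inr i \<in> minimal_elements (Inr ` M \<union> Inl ` K) R"
      using that sub minimal by auto
    then show ?thesis using that unfolding minimal_elements_def by blast
  qed
  have "(u, v) \<in> family_extension M K P (extension_family M K R) \<longleftrightarrow> (u, v) \<in> R" for u v
  proof (cases u; cases v)
    fix x y assume "u = Inl x" "v = Inl y"
    then show ?thesis using Restr_Inl_iff[OF Restr] P sub by auto
  next
    fix i y assume "u = Inr i" "v = Inl y"
    then show ?thesis using sub by (auto simp: extension_family_def)
  next
    fix x j assume "u = Inl x" "v = Inr j"
    then show ?thesis using minimalD by auto
  next
    fix i j assume "u = Inr i" "v = Inr j"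
    then show ?thesis using minimalD refl sub by (auto simp: refl_on_def)
  qed
  then show ?thesis by auto
qed

definition minimal_avoiding_families :: "'b set \<Rightarrow> 'a set \<Rightarrow> 'a rel \<Rightarrow> ('b \<Rightarrow> 'a set) set" where
  "minimal_avoiding_families M K P =
     {f \<in> M \<rightarrow>\<^sub>E downsets K P. minimal_elements K P \<inter> (\<Inter>i\<in>M. f i) = {}}"

lemma extensions_eq_image_family_extension:
  assumes po: "partial_order_on K P"
  shows "extensions (Inr ` M) (Inl ` K) (map_prod Inl Inl ` P)
    = family_extension M K P ` minimal_avoiding_families M K P"
proof (intro subset_antisym subsetI)
  fix R assume "R \<in> extensions (Inr ` M) (Inl ` K) (map_prod Inl Inl ` P)"
  then have R: "partial_order_on (Inr ` M \<union> Inl ` K) R"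
    and Restr: "Restr R (Inl ` K) = map_prod Inl Inl ` P"
    and minimal: "minimal_elements (Inr ` M \<union> Inl ` K) R = Inr ` M"
    by (auto simp: extensions_def)
  let ?f = "extension_family M K R"
  have R_eq: "family_extension M K P ?f = R"
    using R Restr partial_order_onD(4)[OF po] minimal by (intro family_extension_extension_family) auto
  have "minimal_elements K P \<inter> (\<Inter>i\<in>M. ?f i) = {}"
    using minimal minimal_elements_family_extension[of M K P ?f] unfolding R_eq by blast
  then have "?f \<in> minimal_avoiding_families M K P"
    using extension_family_in_PiE[OF partial_order_onD(2)[OF R] Restr]
    by (simp add: minimal_avoiding_families_def)
  then show "R \<in> family_extension M K P ` minimal_avoiding_families M K P"
    using R_eq by blast
next
  fix R assume "R \<in> family_extension M K P ` minimal_avoiding_families M K P"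
  then obtain f where f: "f \<in> M \<rightarrow> downsets K P"
    and avoiding: "minimal_elements K P \<inter> (\<Inter>i\<in>M. f i) = {}"
    and R: "R = family_extension M K P f"
    by (auto simp: minimal_avoiding_families_def PiE_def)
  show "R \<in> extensions (Inr ` M) (Inl ` K) (map_prod Inl Inl ` P)"
    unfolding R using avoiding partial_order_on_family_extension[OF po f] partial_order_onD(4)[OF po]
    by (simp add: extensions_def Restr_family_extension minimal_elements_family_extension)
qed

lemma num_extensions_eq_card_families:
  assumes "partial_order_on K P"
  shows "num_extensions m K P = card (minimal_avoiding_families {..<m} K P)"
proof -
  have "minimal_avoiding_families {..<m} K P \<subseteq> {..<m} \<rightarrow>\<^sub>E Pow K"
    using PiE_mono[of "{..<m}" "\<lambda>_. downsets K P" "\<lambda>_. Pow K"] downsets_subset_Pow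
    by (auto simp: minimal_avoiding_families_def)
  then show ?thesis
    unfolding num_extensions_def extensions_eq_image_family_extension[OF assms]
    by (intro card_image inj_on_subset[OF inj_on_family_extension])
qed

section \<open>The deficit\<close>

lemma extension_deficit_eq_card:
  assumes "finite K" and po: "partial_order_on K P"
  shows "extension_deficit m K P
    = int (card (\<Union>p\<in>minimal_elements K P. {..<m} \<rightarrow>\<^sub>E {D \<in> downsets K P. p \<in> D}))"
    (is "_ = int (card ?B)")
proof -
  let ?F = "{..<m} \<rightarrow>\<^sub>E downsets K P" and ?G = "minimal_avoiding_families {..<m} K P"
  have fin: "finite ?F" using assms(1) by (intro finite_PiE finite_downsets) auto
  have sub: "?G \<subseteq> ?F" by (auto simp: minimal_avoiding_families_def)
  have "?B = ?F - ?G"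
  proof (rule set_eqI)
    show "f \<in> ?B \<longleftrightarrow> f \<in> ?F - ?G" for f
      by (auto simp: minimal_avoiding_families_def PiE_iff)
  qed
  then have "card ?B = card ?F - card ?G"
    using card_Diff_subset[OF finite_subset[OF sub fin] sub] by simp
  moreover have "card ?G \<le> card ?F"
    using fin sub by (rule card_mono)
  moreover have "card ?F = num_downsets K P ^ m"
    by (simp add: card_funcsetE num_downsets_def)
  ultimately show ?thesis
    by (simp add: extension_deficit_def num_extensions_eq_card_families[OF po] of_nat_diff)
qed

lemma extension_deficit_nonneg:
  "finite K \<Longrightarrow> partial_order_on K P \<Longrightarrow> 0 \<le> extension_deficit m K P"
  by (simp add: extension_deficit_eq_card)

lemma extension_deficit_le_num_minimal:
  assumes "finite K" and po: "partial_order_on K P"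
  shows "extension_deficit m K P \<le> int (num_minimal K P * max_proper_downsets K P ^ m)"
proof -
  let ?B = "\<lambda>p. {..<m} \<rightarrow>\<^sub>E {D \<in> downsets K P. p \<in> D}"
  have "card (?B p) \<le> max_proper_downsets K P ^ m" if "p \<in> minimal_elements K P" for p
  proof -
    have "p \<in> K" using that by (simp add: minimal_elements_def)
    then show ?thesis
      using card_downsets_containing_le[OF assms(1)] by (simp add: card_funcsetE power_mono)
  qed
  then have "(\<Sum>p\<in>minimal_elements K P. card (?B p)) \<le> num_minimal K P * max_proper_downsets K P ^ m"
    using sum_bounded_above[of "minimal_elements K P" "\<lambda>p. card (?B p)"]
    by (simp add: num_minimal_def)
  moreover have "card (\<Union>p\<in>minimal_elements K P. ?B p) \<le> (\<Sum>p\<in>minimal_elements K P. card (?B p))"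
    using assms(1) by (intro card_UN_le finite_minimal_elements)
  ultimately show ?thesis
    unfolding extension_deficit_eq_card[OF assms] by linarith
qed

lemma extension_deficit_le:
  assumes "finite K" and "partial_order_on K P"
  shows "extension_deficit m K P \<le> 2 ^ (num_minimal K P - 1) * int (max_proper_downsets K P) ^ m"
proof -
  have "n \<le> 2 ^ (n - 1)" for n :: nat
    using less_exp[of "n - 1"] by linarith
  then have "num_minimal K P * max_proper_downsets K P ^ m
      \<le> 2 ^ (num_minimal K P - 1) * max_proper_downsets K P ^ m"
    by (rule mult_right_mono) simp
  then have "int (num_minimal K P * max_proper_downsets K P ^ m)
      \<le> int (2 ^ (num_minimal K P - 1) * max_proper_downsets K P ^ m)"
    by (rule of_nat_mono)
  then show ?thesis
    using extension_deficit_le_num_minimal[OF assms, of m] by simp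
qed

lemma power_num_minimal_mult_max_proper_downsets_le:
  assumes "finite K" and "K \<noteq> {}"
  shows "(2::int) ^ (num_minimal K P - 1) * int (max_proper_downsets K P) ^ m
    \<le> 2 ^ ((card K - 1) * (m + 1))"
proof -
  have "(2::int) ^ (num_minimal K P - 1) \<le> 2 ^ (card K - 1)"
    using num_minimal_le_card[OF assms(1), of P] by (intro power_increasing diff_le_mono) auto
  moreover have "int (max_proper_downsets K P) ^ m \<le> (2 ^ (card K - 1)) ^ m"
    using of_nat_mono[OF max_proper_downsets_le_power[OF assms, of P], where 'a = int]
    by (intro power_mono) simp_all
  ultimately have "(2::int) ^ (num_minimal K P - 1) * int (max_proper_downsets K P) ^ m
      \<le> 2 ^ (card K - 1) * (2 ^ (card K - 1)) ^ m"
    by (intro mult_mono) auto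
  also have "\<dots> = 2 ^ ((card K - 1) * (m + 1))"
    by (simp add: power_mult power_add)
  finally show ?thesis .
qed

section \<open>Asymptotics\<close>

lemma power_smallo_power:
  fixes a b :: real
  assumes "0 \<le> a" and "a < b"
  shows "(\<lambda>n. a ^ n) \<in> o(\<lambda>n. b ^ n)"
proof (rule smalloI_tendsto)
  have "(\<lambda>n. (a / b) ^ n) \<longlonglongrightarrow> 0"
    using assms by (intro LIMSEQ_realpow_zero) auto
  then show "(\<lambda>n. a ^ n / b ^ n) \<longlonglongrightarrow> 0" by (simp add: power_divide)
qed (use assms in simp)

lemma extension_deficit_bigo:
  assumes "finite K" and "partial_order_on K P"
  shows "(\<lambda>m. real_of_int (extension_deficit m K P)) \<in> O(\<lambda>m. real (max_proper_downsets K P) ^ m)"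
proof (intro bigoI always_eventually allI)
  fix m
  have "real_of_int (extension_deficit m K P)
      \<le> real_of_int (int (num_minimal K P * max_proper_downsets K P ^ m))"
    using extension_deficit_le_num_minimal[OF assms] by (rule of_int_le_iff[THEN iffD2])
  then show "norm (real_of_int (extension_deficit m K P))
      \<le> real (num_minimal K P) * norm (real (max_proper_downsets K P) ^ m)"
    using extension_deficit_nonneg[OF assms] by simp
qed

lemma num_extensions_eq_power_times:
  assumes "finite K" and "partial_order_on K P"
  shows "\<exists>h. h \<in> O(\<lambda>m. downset_ratio K P ^ m)
    \<and> (\<forall>m. real (num_extensions m K P) = real (num_downsets K P) ^ m * (1 - h m))"
proof (intro exI conjI allI)
  let ?h = "\<lambda>m. real_of_int (extension_deficit m K P) / real (num_downsets K P) ^ m"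
  have d: "real (num_downsets K P) > 0" using num_downsets_pos[OF assms(1)] by simp
  have "?h \<in> O(\<lambda>m. real (max_proper_downsets K P) ^ m / real (num_downsets K P) ^ m)"
    using extension_deficit_bigo[OF assms] d by (intro landau_o.big.divide_right) auto
  then show "?h \<in> O(\<lambda>m. downset_ratio K P ^ m)"
    by (simp add: downset_ratio_def power_divide)
  show "real (num_extensions m K P) = real (num_downsets K P) ^ m * (1 - ?h m)" for m
    using d by (simp add: extension_deficit_def field_simps)
qed

lemma num_extensions_asymp_equiv:
  assumes "finite K" and "K \<noteq> {}" and "partial_order_on K P"
  shows "(\<lambda>m. real (num_extensions m K P)) \<sim>[at_top] (\<lambda>m. real (num_downsets K P) ^ m)"
proof (rule smallo_imp_asymp_equiv)
  have "(\<lambda>m. real_of_int (extension_deficit m K P)) \<in> o(\<lambda>m. real (num_downsets K P) ^ m)"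
    using extension_deficit_bigo[OF assms(1,3)]
  proof (rule landau_o.big_small_trans)
    show "(\<lambda>m. real (max_proper_downsets K P) ^ m) \<in> o(\<lambda>m. real (num_downsets K P) ^ m)"
      using max_proper_downsets_less[OF assms] by (intro power_smallo_power) auto
  qed
  then have "(\<lambda>m. - real_of_int (extension_deficit m K P)) \<in> o(\<lambda>m. real (num_downsets K P) ^ m)"
    by simp
  then show "(\<lambda>m. real (num_extensions m K P) - real (num_downsets K P) ^ m)
      \<in> o(\<lambda>m. real (num_downsets K P) ^ m)"
    by (simp add: extension_deficit_def)
qed

theorem theorem6p2:
  fixes K :: "'a set" and P :: "'a rel" and k :: nat
  assumes "finite K" and "K \<noteq> {}" and "card K = k" and "partial_order_on K P"
  shows "max_proper_downsets K P \<le> 2 ^ (k - 1)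
    \<and> downset_ratio K P < 1
    \<and> (\<forall>m::nat. m > 0 \<longrightarrow>
          0 \<le> extension_deficit m K P
        \<and> extension_deficit m K P
            \<le> 2 ^ (num_minimal K P - 1) * int (max_proper_downsets K P) ^ m
        \<and> (2::int) ^ (num_minimal K P - 1) * int (max_proper_downsets K P) ^ m
            \<le> 2 ^ ((k - 1) * (m + 1)))
    \<and> (\<exists>h. h \<in> O(\<lambda>m. downset_ratio K P ^ m)
        \<and> (\<forall>m. real (num_extensions m K P) = real (num_downsets K P) ^ m * (1 - h m)))
    \<and> (\<lambda>m. real (num_extensions m K P)) \<sim>[at_top] (\<lambda>m. real (num_downsets K P) ^ m)"
proof (intro conjI allI impI)
  show "max_proper_downsets K P \<le> 2 ^ (k - 1)"
    using max_proper_downsets_le_power[OF assms(1,2)] assms(3) by simp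
  show "downset_ratio K P < 1"
    using assms(1,2,4) by (rule downset_ratio_less_1)
  show "\<exists>h. h \<in> O(\<lambda>m. downset_ratio K P ^ m)
      \<and> (\<forall>m. real (num_extensions m K P) = real (num_downsets K P) ^ m * (1 - h m))"
    using assms(1,4) by (rule num_extensions_eq_power_times)
  show "(\<lambda>m. real (num_extensions m K P)) \<sim>[at_top] (\<lambda>m. real (num_downsets K P) ^ m)"
    using assms(1,2,4) by (rule num_extensions_asymp_equiv)
next
  fix m :: nat
  show "0 \<le> extension_deficit m K P"
    using assms(1,4) by (rule extension_deficit_nonneg)
  show "extension_deficit m K P \<le> 2 ^ (num_minimal K P - 1) * int (max_proper_downsets K P) ^ m"
    using assms(1,4) by (rule extension_deficit_le)
  show "(2::int) ^ (num_minimal K P - 1) * int (max_proper_downsets K P) ^ m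
      \<le> 2 ^ ((k - 1) * (m + 1))"
    using power_num_minimal_mult_max_proper_downsets_le[OF assms(1,2)] assms(3) by simp
qed

end
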